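(* The set of diagonal Green function values of a finite abstract simplicial complex is a combinatorial invariant: for every finite abstract simplicial complex $G$ with Barycentric refinement $G_1$, $$\{\, (1+A(G'))^{-1}_{xx} \;:\; x \in V(G') \,\} = \{\, (1+A((G_1)'))^{-1}_{xx} \;:\; x\in V((G_1)') \,\}$$ as sets of integers.
   Context: A finite abstract simplicial complex $G$ is a finite set of non-empty finite sets (simplices) closed under taking non-empty subsets; $\dim(x)=|x|-1$. The Barycentric refinement $G_1$ is the graph whose vertices are the simplices of $G$, two distinct simplices being adjacent if one is a subset of the other; it is regarded as a simplicial complex via its Whitney complex, whose simplices are the vertex sets of the non-empty complete subgraphs. The connection graph $K'$ of a complex $K$ has the simplices of $K$ as vertices, two distinct simplices being adjacent if they have non-empty intersection. $A(\cdot)$ denotes the adjacency matrix and $1$ the identity matrix; $1+A(K')$ is invertible over $\mathbb{Z}$ by the known unimodularity theorem $\det(1+A(K'))=\prod_{x\in K}(-1)^{\dim(x)}$. A combinatorial invariant is a quantity which does not change when passing from a complex to its Barycentric refinement. *)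

theory Defs
  imports Main
begin

definition finite_abstract_complex :: "'a set set \<Rightarrow> bool" where
  "finite_abstract_complex G \<longleftrightarrow>
     finite G \<and> (\<forall>x\<in>G. finite x \<and> x \<noteq> {}) \<and>
     (\<forall>x\<in>G. \<forall>y. y \<subseteq> x \<and> y \<noteq> {} \<longrightarrow> y \<in> G)"

record 'v graph =
  vertices :: "'v set"
  edges :: "'v set set"

definition whitney_complex :: "'v graph \<Rightarrow> 'v set set" where
  "whitney_complex \<Gamma> =
     {S. S \<subseteq> vertices \<Gamma> \<and> finite S \<and> S \<noteq> {} \<and>
         (\<forall>u\<in>S. \<forall>v\<in>S. u \<noteq> v \<longrightarrow> {u, v} \<in> edges \<Gamma>)}"

definition barycentric_graph :: "'a set set \<Rightarrow> 'a set graph" where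
  "barycentric_graph G =
     \<lparr>vertices = G,
      edges = {{x, y} | x y. x \<in> G \<and> y \<in> G \<and> x \<noteq> y \<and> (x \<subseteq> y \<or> y \<subseteq> x)}\<rparr>"

definition barycentric_refinement :: "'a set set \<Rightarrow> 'a set set set" where
  "barycentric_refinement G = whitney_complex (barycentric_graph G)"

definition connection_graph :: "'a set set \<Rightarrow> 'a set graph" where
  "connection_graph K =
     \<lparr>vertices = K,
      edges = {{x, y} | x y. x \<in> K \<and> y \<in> K \<and> x \<noteq> y \<and> x \<inter> y \<noteq> {}}\<rparr>"

text \<open>
  A matrix with rows and columns indexed by a finite set \<open>V\<close> is a function of two arguments;
  only its values on \<open>V\<close> are relevant.
\<close>

definition identity_matrix :: "'v \<Rightarrow> 'v \<Rightarrow> int" where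
  "identity_matrix u v = (if u = v then 1 else 0)"

definition adjacency_matrix :: "'v graph \<Rightarrow> 'v \<Rightarrow> 'v \<Rightarrow> int" where
  "adjacency_matrix \<Gamma> u v = (if u \<noteq> v \<and> {u, v} \<in> edges \<Gamma> then 1 else 0)"

definition is_inverse_on ::
  "'v set \<Rightarrow> ('v \<Rightarrow> 'v \<Rightarrow> int) \<Rightarrow> ('v \<Rightarrow> 'v \<Rightarrow> int) \<Rightarrow> bool" where
  "is_inverse_on V M N \<longleftrightarrow>
     (\<forall>u\<in>V. \<forall>v\<in>V. (\<Sum>w\<in>V. M u w * N w v) = identity_matrix u v) \<and>
     (\<forall>u\<in>V. \<forall>v\<in>V. (\<Sum>w\<in>V. N u w * M w v) = identity_matrix u v)"

text \<open>
  Entries outside \<open>V\<close> are set to zero so that the inverse is unique as a function.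
  If \<open>M\<close> has no inverse over the integers, the value is unspecified.
\<close>

definition matrix_inverse_on ::
  "'v set \<Rightarrow> ('v \<Rightarrow> 'v \<Rightarrow> int) \<Rightarrow> ('v \<Rightarrow> 'v \<Rightarrow> int)" where
  "matrix_inverse_on V M =
     (THE N. is_inverse_on V M N \<and> (\<forall>u v. u \<notin> V \<or> v \<notin> V \<longrightarrow> N u v = 0))"

lemma is_inverse_on_unique:
  assumes fin: "finite V"
    and N: "is_inverse_on V M N" and N': "is_inverse_on V M N'"
    and u: "u \<in> V" and v: "v \<in> V"
  shows "N u v = N' u v"
proof -
  have "N u v = (\<Sum>w\<in>V. N u w * identity_matrix w v)"
    using fin v by (simp add: identity_matrix_def if_distrib cong: if_cong)
  also have "\<dots> = (\<Sum>w\<in>V. N u w * (\<Sum>z\<in>V. M w z * N' z v))"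
    using N' v by (intro sum.cong) (auto simp: is_inverse_on_def)
  also have "\<dots> = (\<Sum>w\<in>V. \<Sum>z\<in>V. N u w * M w z * N' z v)"
    by (simp add: sum_distrib_left mult.assoc)
  also have "\<dots> = (\<Sum>z\<in>V. \<Sum>w\<in>V. N u w * M w z * N' z v)"
    by (rule sum.swap)
  also have "\<dots> = (\<Sum>z\<in>V. (\<Sum>w\<in>V. N u w * M w z) * N' z v)"
    by (simp add: sum_distrib_right)
  also have "\<dots> = (\<Sum>z\<in>V. identity_matrix u z * N' z v)"
    using N u by (intro sum.cong) (auto simp: is_inverse_on_def)
  also have "\<dots> = N' u v"
    using fin u by (simp add: identity_matrix_def if_distribR if_distrib cong: if_cong)
  finally show ?thesis .
qed

lemma matrix_inverse_on_eq:
  assumes fin: "finite V" and N: "is_inverse_on V M N" and u: "u \<in> V" and v: "v \<in> V"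
  shows "matrix_inverse_on V M u v = N u v"
proof -
  define N0 where "N0 = (\<lambda>u v. if u \<in> V \<and> v \<in> V then N u v else 0)"
  have inv: "is_inverse_on V M N0"
    using N by (simp add: is_inverse_on_def N0_def cong: sum.cong)
  have "matrix_inverse_on V M = N0"
    unfolding matrix_inverse_on_def
  proof (rule the_equality)
    show "is_inverse_on V M N0 \<and> (\<forall>u v. u \<notin> V \<or> v \<notin> V \<longrightarrow> N0 u v = 0)"
      using inv by (auto simp: N0_def)
  next
    fix L assume L: "is_inverse_on V M L \<and> (\<forall>u v. u \<notin> V \<or> v \<notin> V \<longrightarrow> L u v = 0)"
    show "L = N0"
    proof (intro ext)
      fix a b
      show "L a b = N0 a b"
        using L inv is_inverse_on_unique[OF fin, of M L N0 a b]
        by (cases "a \<in> V \<and> b \<in> V") (auto simp: N0_def)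
    qed
  qed
  then show ?thesis
    using u v by (simp add: N0_def)
qed

definition green_function :: "'a set set \<Rightarrow> 'a set \<Rightarrow> 'a set \<Rightarrow> int" where
  "green_function K =
     matrix_inverse_on (vertices (connection_graph K))
       (\<lambda>x y. identity_matrix x y + adjacency_matrix (connection_graph K) x y)"

end

theory Submission
  imports Complex_Main Defs
begin

text \<open>
  For a complex \<open>K\<close>, the diagonal Green function value at \<open>x\<close> is the Euler characteristic of the
  star of \<open>x\<close>. A simplex \<open>c\<close> of the Barycentric refinement is a chain in \<open>G\<close>, and its star consists
  of the chains \<open>d \<supseteq> c\<close>. Grouping these by their largest element \<open>m\<close>, each \<open>m \<supseteq> \<Union>c\<close> in \<open>G\<close>
  contributes exactly \<open>(-1)^dim(m)\<close>: removing \<open>m\<close> from \<open>d\<close> gives an induction on \<open>m\<close>, in which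
  the alternating sum over a nondegenerate interval of subsets vanishes. So the value at \<open>c\<close> equals the value of \<open>G\<close> at the largest element \<open>\<Union>c\<close> of \<open>c\<close>, and
  every \<open>x \<in> G\<close> is the largest element of the chain \<open>{x}\<close>.
\<close>

section \<open>Alternating sums over intervals of subsets\<close>

text \<open>For \<open>a \<noteq> m\<close>, toggling a fixed element of \<open>m - a\<close> pairs
  the even sets of the interval with the odd ones.\<close>

lemma sum_sign_interval:
  assumes "finite m" "a \<subseteq> m"
  shows "(\<Sum>t | a \<subseteq> t \<and> t \<subseteq> m. (-1::int) ^ card t) = (if a = m then (-1) ^ card m else 0)"
proof (cases "a = m")
  case True
  then have "{t. a \<subseteq> t \<and> t \<subseteq> m} = {m}" by auto
  with True show ?thesis by simp
next
  case False
  have "finite {t. a \<subseteq> t \<and> t \<subseteq> m}"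
    using assms(1) by (auto intro: finite_subset[of _ "Pow m"])
  moreover have "card {t. t \<subseteq> m \<and> a \<subseteq> t \<and> even (card t)} = card {t. t \<subseteq> m \<and> a \<subseteq> t \<and> odd (card t)}"
    using assms False by (intro card_subsupersets_even_odd) auto
  ultimately show ?thesis
    using False by (simp add: sum_alternating_cancels conj_ac)
qed

text \<open>The subsets of \<open>z\<close> disjoint from \<open>x\<close> are those of
  \<open>z - x\<close>. The total over \<open>Pow z\<close> vanishes, so the sum is minus the one
  over \<open>Pow (z - x)\<close>, which is non-zero only if \<open>z - x\<close> is empty.\<close>

lemma sum_sign_meeting:
  assumes "finite z" "z \<noteq> {}"
  shows "(\<Sum>y | y \<subseteq> z \<and> x \<inter> y \<noteq> {}. (-1::int) ^ card y) = (if z \<subseteq> x then -1 else 0)"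
proof -
  have split: "Pow z = {y. y \<subseteq> z \<and> x \<inter> y \<noteq> {}} \<union> Pow (z - x)" by auto
  have "(\<Sum>y\<in>Pow z. (-1::int) ^ card y) =
        (\<Sum>y | y \<subseteq> z \<and> x \<inter> y \<noteq> {}. (-1) ^ card y) + (\<Sum>y\<in>Pow (z - x). (-1) ^ card y)"
    unfolding split using assms(1) by (intro sum.union_disjoint) auto
  moreover have "(\<Sum>y\<in>Pow z. (-1::int) ^ card y) = 0"
    using sum_sign_interval[of z "{}"] assms by (simp add: Pow_def)
  moreover have "(\<Sum>y\<in>Pow (z - x). (-1::int) ^ card y) = (if z \<subseteq> x then 1 else 0)"
    using sum_sign_interval[of "z - x" "{}"] assms(1)
    by (simp add: Pow_def eq_commute[of "{}"] Diff_eq_empty_iff[THEN iffD2])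
  ultimately show ?thesis by (simp split: if_splits)
qed

section \<open>The inverse of the connection matrix\<close>

text \<open>The exponent has the parity of the dimension \<open>card z - 1\<close> without truncated
  subtraction. The inverse below evaluates this at unions of two simplices; where such a union is
  not a simplex, the sum is empty.\<close>

definition star_char :: "'a set set \<Rightarrow> 'a set \<Rightarrow> int" where
  "star_char K x = (\<Sum>z | z \<in> K \<and> x \<subseteq> z. (-1) ^ (card z + 1))"

text \<open>Expanding \<open>star_char\<close> and exchanging sums puts the simplex \<open>z\<close>
  containing \<open>y \<union> v\<close> outside. Summing over \<open>y\<close> by
  \<open>sum_sign_meeting\<close> leaves only \<open>z \<subseteq> x\<close>, and the remaining sum
  over the interval from \<open>v\<close> to \<open>x\<close> gives the identity. Symmetry of both
  matrices yields the product in the other order.\<close>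

lemma is_inverse_on_star_char:
  assumes K: "finite_abstract_complex K"
  shows "is_inverse_on K
    (\<lambda>x y. identity_matrix x y + adjacency_matrix (connection_graph K) x y)
    (\<lambda>x y. (-1) ^ (card x + card y) * star_char K (x \<union> y))"
    (is "is_inverse_on K ?M ?N")
proof -
  have fin: "finite K" and simplex: "\<And>x. x \<in> K \<Longrightarrow> finite x \<and> x \<noteq> {}"
    and sub: "\<And>x y. x \<in> K \<Longrightarrow> y \<subseteq> x \<Longrightarrow> y \<noteq> {} \<Longrightarrow> y \<in> K"
    using K unfolding finite_abstract_complex_def by blast+
  have M: "?M x y = (if x \<inter> y \<noteq> {} then 1 else 0)" if "x \<in> K" "y \<in> K" for x y
    using that simplex
    by (auto simp: identity_matrix_def adjacency_matrix_def connection_graph_def doubleton_eq_iff)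
  have M_sym: "?M x y = ?M y x" if "x \<in> K" "y \<in> K" for x y
    using that by (simp only: M Int_commute)
  have N_sym: "?N x y = ?N y x" for x y
    by (simp only: Un_commute add.commute)
  have right: "(\<Sum>y\<in>K. ?M x y * ?N y v) = identity_matrix x v" if x: "x \<in> K" and v: "v \<in> K" for x v
  proof -
    have "(\<Sum>y\<in>K. ?M x y * ?N y v) =
        (\<Sum>y\<in>K. \<Sum>z | z \<in> K \<and> y \<union> v \<subseteq> z.
           (if x \<inter> y \<noteq> {} then (-1) ^ (card v + card z + 1) * (-1) ^ card y else 0))"
      using x by (intro sum.cong)
        (auto simp: M star_char_def sum_distrib_left power_add mult_ac simp del: One_nat_def intro!: sum.cong)
    also have "\<dots> = (\<Sum>z\<in>K. \<Sum>y | y \<in> K \<and> y \<union> v \<subseteq> z.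
           (if x \<inter> y \<noteq> {} then (-1) ^ (card v + card z + 1) * (-1) ^ card y else 0))"
      by (rule sum.swap_restrict[OF fin fin])
    also have "\<dots> = (\<Sum>z\<in>K. if v \<subseteq> z \<and> z \<subseteq> x then (-1) ^ (card v + card z) else 0)"
    proof (rule sum.cong[OF refl])
      fix z assume z: "z \<in> K"
      show "(\<Sum>y | y \<in> K \<and> y \<union> v \<subseteq> z.
              (if x \<inter> y \<noteq> {} then (-1) ^ (card v + card z + 1) * (-1) ^ card y else 0)) =
            (if v \<subseteq> z \<and> z \<subseteq> x then (-1::int) ^ (card v + card z) else 0)"
      proof (cases "v \<subseteq> z")
        case True
        \<comment> \<open>A subset of \<open>z\<close> meeting \<open>x\<close> is non-empty, hence
          in \<open>K\<close> by closure.\<close>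
        have "(\<Sum>y | y \<in> K \<and> y \<union> v \<subseteq> z.
              (if x \<inter> y \<noteq> {} then (-1) ^ (card v + card z + 1) * (-1) ^ card y else 0)) =
            (\<Sum>y | y \<subseteq> z \<and> x \<inter> y \<noteq> {}. (-1::int) ^ (card v + card z + 1) * (-1) ^ card y)"
          using True z sub fin simplex[OF z]
          by (intro sum.mono_neutral_cong) auto
        also have "\<dots> = (-1) ^ (card v + card z + 1) * (if z \<subseteq> x then -1 else 0)"
          using simplex[OF z] unfolding sum_distrib_left[symmetric] by (simp add: sum_sign_meeting)
        finally show ?thesis using True by simp
      qed auto
    qed
    \<comment> \<open>Sets between the simplices \<open>v\<close> and \<open>x\<close> are non-empty
      subsets of \<open>x\<close>, so all of them lie in \<open>K\<close> and the index set is a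
      full interval.\<close>
    also have "\<dots> = (\<Sum>z | v \<subseteq> z \<and> z \<subseteq> x. (-1) ^ card v * (-1) ^ card z)"
      using sub[OF x] simplex[OF v] simplex[OF x] fin
      by (intro sum.mono_neutral_cong) (auto simp: power_add)
    also have "\<dots> = identity_matrix x v"
    proof (cases "v \<subseteq> x")
      case True
      with simplex[OF x] show ?thesis
        unfolding sum_distrib_left[symmetric]
        by (simp add: sum_sign_interval identity_matrix_def flip: power_add)
    next
      case False
      then have "{z. v \<subseteq> z \<and> z \<subseteq> x} = {}" and "x \<noteq> v" by auto
      then show ?thesis by (simp only: identity_matrix_def sum.empty if_False)
    qed
    finally show ?thesis .
  qed
  have "(\<Sum>y\<in>K. ?N x y * ?M y v) = identity_matrix x v" if x: "x \<in> K" and v: "v \<in> K" for x v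
  proof -
    have "(\<Sum>y\<in>K. ?N x y * ?M y v) = (\<Sum>y\<in>K. ?M v y * ?N y x)"
    proof (rule sum.cong[OF refl])
      fix y assume y: "y \<in> K"
      show "?N x y * ?M y v = ?M v y * ?N y x"
        unfolding N_sym[of x y] M_sym[OF y v] by (rule mult.commute)
    qed
    also have "\<dots> = identity_matrix v x"
      by (rule right[OF v x])
    also have "\<dots> = identity_matrix x v"
      by (simp add: identity_matrix_def)
    finally show ?thesis .
  qed
  with right show ?thesis
    unfolding is_inverse_on_def by blast
qed

lemma green_function_diagonal:
  assumes "finite_abstract_complex K" "x \<in> K"
  shows "green_function K x x = star_char K x"
proof -
  have V: "vertices (connection_graph K) = K"
    by (simp add: connection_graph_def)
  show ?thesis
    unfolding green_function_def V
    using assms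
    by (subst matrix_inverse_on_eq[OF _ is_inverse_on_star_char[OF assms(1)]])
       (auto simp: finite_abstract_complex_def simp flip: mult_2)
qed

section \<open>Chains with a prescribed union\<close>

text \<open>For finite non-empty \<open>m\<close>, the union is the largest element of the chain.
  Prescribing the union instead also admits the empty chain for \<open>m = {}\<close>, where the
  induction below starts.\<close>

definition chains_onto :: "'a set set \<Rightarrow> 'a set \<Rightarrow> 'a set set set" where
  "chains_onto c m = {d. subset.chain UNIV d \<and> {} \<notin> d \<and> c \<subseteq> d \<and> \<Union>d = m}"

lemma Union_chain_mem:
  assumes "subset.chain UNIV d" "\<Union>d = m" "finite m" "m \<noteq> {}"
  shows "m \<in> d"
proof -
  have "d \<subseteq> Pow m" using assms(2) by auto
  then have "finite d" using assms(3) by (simp add: finite_subset)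
  moreover have "d \<noteq> {}" using assms by auto
  ultimately show ?thesis using Union_in_chain assms(1,2) by blast
qed

lemma sum_sign_chains_onto:
  assumes "finite m" "subset.chain UNIV c" "{} \<notin> c" "\<Union>c \<subseteq> m"
  shows "(\<Sum>d\<in>chains_onto c m. (-1::int) ^ card d) = (-1) ^ card m"
  using assms
proof (induction m arbitrary: c rule: finite_psubset_induct)
  case (psubset m)
  show ?case
  proof (cases "m = {}")
    case True
    with psubset.prems have "c = {}" by auto
    with True have "chains_onto c m = {{}}"
      by (auto simp: chains_onto_def subset.chain_def)
    with True show ?thesis by simp
  next
    case False
    \<comment> \<open>Each chain onto \<open>m\<close> is \<open>insert m e\<close> with
      \<open>m\<close> not in \<open>e\<close>, and it contains \<open>c\<close> iff
      \<open>e\<close> contains \<open>c'\<close>. This treats \<open>m \<in> c\<close> and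
      \<open>m \<notin> c\<close> alike, but the induction must then allow \<open>c\<close> to
      vary.\<close>
    define c' where "c' = c - {m}"
    define D where "D = {d. subset.chain UNIV d \<and> {} \<notin> d \<and> c' \<subseteq> d \<and> \<Union>d \<subset> m}"
    define T where "T = {t. \<Union>c' \<subseteq> t \<and> t \<subset> m}"
    have c': "subset.chain UNIV c'" "{} \<notin> c'" "\<Union>c' \<subseteq> m"
      using psubset.prems by (auto simp: c'_def subset.chain_def)
    \<comment> \<open>A finite chain with union \<open>m\<close> would contain \<open>m\<close>,
      which was removed; the interval from \<open>\<Union>c'\<close> to \<open>m\<close> is
      therefore nondegenerate.\<close>
    have proper: "\<Union>c' \<noteq> m"
      using Union_chain_mem[OF c'(1) _ psubset.hyps(1) False] by (auto simp: c'_def)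
    have "T \<subseteq> Pow m" "D \<subseteq> Pow (Pow m)"
      by (auto simp: T_def D_def)
    then have finT: "finite T" and finD: "finite D"
      using psubset.hyps(1) by (simp_all add: finite_subset)
    have m_notin: "m \<notin> d" and fin_d: "finite d" if "d \<in> D" for d
    proof -
      show "m \<notin> d" using that by (auto simp: D_def)
      have "d \<subseteq> Pow m" using that by (auto simp: D_def)
      then show "finite d" using psubset.hyps(1) by (simp add: finite_subset)
    qed
    have img: "chains_onto c m = insert m ` D"
    proof (intro equalityI subsetI)
      fix d assume d: "d \<in> chains_onto c m"
      then have chain: "subset.chain UNIV d" and U: "\<Union>d = m" and ne: "{} \<notin> d" and "c \<subseteq> d"
        by (auto simp: chains_onto_def)
      have md: "m \<in> d"
        using Union_chain_mem[OF chain U psubset.hyps(1) False] .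
      have chain': "subset.chain UNIV (d - {m})"
        using chain by (auto simp: subset.chain_def)
      have "\<Union>(d - {m}) \<noteq> m"
        using Union_chain_mem[OF chain' _ psubset.hyps(1) False] by auto
      then have "d - {m} \<in> D"
        using chain' U ne \<open>c \<subseteq> d\<close> by (auto simp: D_def c'_def)
      moreover have "d = insert m (d - {m})" using md by auto
      ultimately show "d \<in> insert m ` D" by blast
    next
      fix d assume "d \<in> insert m ` D"
      then obtain e where e: "e \<in> D" and d: "d = insert m e" by auto
      have "subset.chain UNIV d"
        using e by (auto simp: d D_def subset_chain_insert)
      then show "d \<in> chains_onto c m"
        using e False by (auto simp: chains_onto_def D_def d c'_def)
    qed
    have inj: "inj_on (insert m) D"
      using m_notin by (auto simp: inj_on_def insert_ident)
    have "(\<Sum>d\<in>chains_onto c m. (-1::int) ^ card d) = - (\<Sum>d\<in>D. (-1) ^ card d)"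
      unfolding img by (simp add: sum.reindex[OF inj] m_notin fin_d flip: sum_negf)
    also have "(\<Sum>d\<in>D. (-1::int) ^ card d) = (\<Sum>t\<in>T. \<Sum>d | d \<in> D \<and> \<Union>d = t. (-1) ^ card d)"
      by (rule sum.group[symmetric, OF finD finT]) (auto simp: D_def T_def)
    also have "\<dots> = (\<Sum>t\<in>T. (-1) ^ card t)"
    proof (rule sum.cong[OF refl])
      fix t assume t: "t \<in> T"
      then have "{d. d \<in> D \<and> \<Union>d = t} = chains_onto c' t"
        by (auto simp: D_def T_def chains_onto_def)
      then show "(\<Sum>d | d \<in> D \<and> \<Union>d = t. (-1::int) ^ card d) = (-1) ^ card t"
        using psubset.IH[of t c'] t c' by (simp add: T_def)
    qed
    \<comment> \<open>\<open>T\<close> is that interval without its top \<open>m\<close>, and the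
      alternating sum over the whole interval is zero.\<close>
    also have "\<dots> = - ((-1) ^ card m)"
    proof -
      have "{t. \<Union>c' \<subseteq> t \<and> t \<subseteq> m} = insert m T"
        using c'(3) by (auto simp: T_def)
      moreover have "m \<notin> T" by (simp add: T_def)
      ultimately have "(-1) ^ card m + (\<Sum>t\<in>T. (-1::int) ^ card t) = 0"
        using sum_sign_interval[OF psubset.hyps(1) c'(3)] finT proper by simp
      then show ?thesis by linarith
    qed
    finally show ?thesis by simp
  qed
qed

section \<open>Stars in the Barycentric refinement\<close>

text \<open>Adjacency is comparability under inclusion, so cliques are chains; finiteness of
  \<open>G\<close> supplies that of the cliques.\<close>

lemma barycentric_refinement_eq:
  assumes "finite G"
  shows "barycentric_refinement G = {c. c \<subseteq> G \<and> c \<noteq> {} \<and> subset.chain UNIV c}"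
proof -
  have edge: "{u, v} \<in> edges (barycentric_graph G) \<longleftrightarrow> u \<subseteq> v \<or> v \<subseteq> u"
    if "u \<in> G" "v \<in> G" "u \<noteq> v" for u v
    using that by (auto simp: barycentric_graph_def doubleton_eq_iff)
  have "(\<forall>u\<in>c. \<forall>v\<in>c. u \<noteq> v \<longrightarrow> {u, v} \<in> edges (barycentric_graph G)) \<longleftrightarrow> subset.chain UNIV c"
    (is "?L \<longleftrightarrow> ?R") if "c \<subseteq> G" for c
  proof -
    have "?L \<longleftrightarrow> (\<forall>u\<in>c. \<forall>v\<in>c. u \<noteq> v \<longrightarrow> u \<subseteq> v \<or> v \<subseteq> u)"
      by (intro ball_cong imp_cong refl edge subsetD[OF that])
    also have "\<dots> \<longleftrightarrow> ?R"
      by (auto simp: subset_chain_def)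
    finally show ?thesis .
  qed
  moreover have "vertices (barycentric_graph G) = G"
    by (simp add: barycentric_graph_def)
  ultimately show ?thesis
    using finite_subset[OF _ assms]
    by (simp add: barycentric_refinement_def whitney_complex_def cong: conj_cong)
qed

lemma finite_abstract_complex_barycentric:
  assumes "finite_abstract_complex G"
  shows "finite_abstract_complex (barycentric_refinement G)"
proof -
  have fin: "finite G" using assms by (simp add: finite_abstract_complex_def)
  have "barycentric_refinement G \<subseteq> Pow G"
    using fin by (auto simp: barycentric_refinement_eq)
  then have "finite (barycentric_refinement G)"
    using fin by (simp add: finite_subset)
  moreover have "finite c \<and> c \<noteq> {}" if "c \<in> barycentric_refinement G" for c
    using that fin by (simp add: barycentric_refinement_eq finite_subset[of c G])
  moreover have "d \<in> barycentric_refinement G"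
    if c: "c \<in> barycentric_refinement G" and d: "d \<subseteq> c" "d \<noteq> {}" for c d
  proof -
    have "c \<subseteq> G" "subset.chain UNIV c"
      using c fin by (simp_all add: barycentric_refinement_eq)
    moreover from this have "subset.chain UNIV d"
      using d(1) by (simp add: subset_chain_def subset_iff[of d])
    ultimately have "d \<subseteq> G" "subset.chain UNIV d"
      using d(1) by simp_all
    with d(2) fin show ?thesis
      by (simp add: barycentric_refinement_eq)
  qed
  ultimately show ?thesis
    by (simp add: finite_abstract_complex_def)
qed

lemma Union_barycentric_simplex_mem:
  assumes "finite G" "c \<in> barycentric_refinement G"
  shows "\<Union>c \<in> G"
proof -
  have c: "c \<subseteq> G" "c \<noteq> {}" "subset.chain UNIV c"
    using assms by (simp_all add: barycentric_refinement_eq)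
  then have "\<Union>c \<in> c"
    using Union_in_chain[OF finite_subset[OF c(1) assms(1)]] by blast
  with c(1) show ?thesis by (rule subsetD)
qed

lemma star_char_barycentric:
  assumes G: "finite_abstract_complex G" and c: "c \<in> barycentric_refinement G"
  shows "star_char (barycentric_refinement G) c = star_char G (\<Union>c)"
proof -
  let ?B = "barycentric_refinement G"
  have fin: "finite G" and ne: "\<And>x. x \<in> G \<Longrightarrow> finite x \<and> x \<noteq> {}"
    and sub: "\<And>x y. x \<in> G \<Longrightarrow> y \<subseteq> x \<Longrightarrow> y \<noteq> {} \<Longrightarrow> y \<in> G"
    using G unfolding finite_abstract_complex_def by blast+
  have finB: "finite ?B"
    using finite_abstract_complex_barycentric[OF G] by (simp add: finite_abstract_complex_def)
  have c': "c \<subseteq> G" "c \<noteq> {}" "subset.chain UNIV c"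
    using c fin by (simp_all add: barycentric_refinement_eq)
  have "star_char ?B c = - (\<Sum>d | d \<in> ?B \<and> c \<subseteq> d. (-1) ^ card d)"
    by (simp add: star_char_def sum_negf)
  also have "(\<Sum>d | d \<in> ?B \<and> c \<subseteq> d. (-1::int) ^ card d) =
      (\<Sum>m | m \<in> G \<and> \<Union>c \<subseteq> m. \<Sum>d | d \<in> {d. d \<in> ?B \<and> c \<subseteq> d} \<and> \<Union>d = m. (-1) ^ card d)"
    using fin finB Union_barycentric_simplex_mem[OF fin]
    by (intro sum.group[symmetric]) auto
  also have "\<dots> = (\<Sum>m | m \<in> G \<and> \<Union>c \<subseteq> m. (-1) ^ card m)"
  proof (rule sum.cong[OF refl])
    fix m assume "m \<in> {m. m \<in> G \<and> \<Union>c \<subseteq> m}"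
    then have m: "m \<in> G" "\<Union>c \<subseteq> m" by auto
    \<comment> \<open>Closure of \<open>G\<close> turns any chain of non-empty sets with union
      \<open>m\<close> into a chain of simplices, so the group belonging to \<open>m\<close> is all
      of \<open>chains_onto c m\<close>.\<close>
    have "d \<subseteq> G" if "\<Union>d = m" "{} \<notin> d" for d
    proof
      fix y assume "y \<in> d"
      with that show "y \<in> G" by (intro sub[OF m(1)]) auto
    qed
    moreover have "{} \<notin> G" using ne by blast
    ultimately have "{d. d \<in> {d. d \<in> ?B \<and> c \<subseteq> d} \<and> \<Union>d = m} = chains_onto c m"
      using c' m fin by (auto simp: barycentric_refinement_eq chains_onto_def)
    moreover have "{} \<notin> c" using \<open>{} \<notin> G\<close> c'(1) by blast
    ultimately show "(\<Sum>d | d \<in> {d. d \<in> ?B \<and> c \<subseteq> d} \<and> \<Union>d = m. (-1::int) ^ card d) = (-1) ^ card m"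
      using sum_sign_chains_onto[of m c] c'(3) m(2) ne[OF m(1)] by simp
  qed
  finally show ?thesis
    by (simp add: star_char_def sum_negf)
qed

theorem mainTheorem3:
  fixes G :: "'a set set"
  assumes "finite_abstract_complex G"
  shows "{green_function G x x | x. x \<in> vertices (connection_graph G)} =
         {green_function (barycentric_refinement G) x x | x.
            x \<in> vertices (connection_graph (barycentric_refinement G))}"
proof -
  let ?B = "barycentric_refinement G"
  have fin: "finite G" using assms by (simp add: finite_abstract_complex_def)
  have V: "vertices (connection_graph K) = K" for K :: "'b set set"
    by (simp add: connection_graph_def)
  have "Union ` ?B = G"
  proof (intro equalityI subsetI)
    fix x assume "x \<in> G"
    then have "{x} \<in> ?B" using fin by (simp add: barycentric_refinement_eq subset.chain_def)
    then show "x \<in> Union ` ?B" by (rule rev_image_eqI) simp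
  next
    fix x assume "x \<in> Union ` ?B"
    then show "x \<in> G"
      by (elim imageE) (simp add: Union_barycentric_simplex_mem[OF fin])
  qed
  \<comment> \<open>Several chains may share a union, so this surjection compares sets of values and
    not multiplicities.\<close>
  then have "star_char G ` G = (\<lambda>c. star_char G (\<Union>c)) ` ?B"
    by (metis image_image)
  also have "\<dots> = star_char ?B ` ?B"
    by (intro image_cong refl) (simp add: star_char_barycentric[OF assms])
  finally have "(\<lambda>x. green_function G x x) ` G = (\<lambda>x. green_function ?B x x) ` ?B"
    using green_function_diagonal[OF assms]
      green_function_diagonal[OF finite_abstract_complex_barycentric[OF assms]]
    by (simp cong: image_cong)
  then show ?thesis
    by (simp add: V Setcompr_eq_image)
qed

end
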